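(* Let $h$ be a rational function with $h\not\equiv 1$. Let $L_1$ and $L_2$ be two $L$-functions (elements of the extended Selberg class $\mathcal{S}^{\sharp}$). If $L_1-h$ and $L_2-h$ have the same zeros counting multiplicities, then $L_1\equiv L_2$.
   Context: An $L$-function means an element of the extended Selberg class $\mathcal{S}^{\sharp}$, i.e. a Dirichlet series $L(s)=\sum_{n=1}^{\infty}\frac{a(n)}{n^s}$ with $a(1)=1$, identified with its meromorphic continuation to $\mathbb{C}$, satisfying: (i) Ramanujan hypothesis: $a(n)\ll n^{\varepsilon}$ for every $\varepsilon>0$; (ii) Analytic continuation: there is a non-negative integer $k$ such that $(s-1)^kL(s)$ is an entire function of finite order; (iii) Functional equation: $\Lambda_L(s)=\omega\overline{\Lambda_L(1-\overline{s})}$, where $\Lambda_L(s)=L(s)Q^s\prod_{j=1}^{K}\Gamma(\lambda_js+\mu_j)$ with constants $Q>0$, $\lambda_j>0$, $\mathrm{Re}\,\mu_j\ge 0$, $|\omega|=1$ (the empty product, $K=0$, is allowed). No Euler product is assumed. "Same zeros counting multiplicities" means that a point of $\mathbb{C}$ is a zero of multiplicity $m$ of one function if and only if it is a zero of multiplicity $m$ of the other. *)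

theory Defs
  imports
    "HOL-Complex_Analysis.Complex_Analysis"
    "HOL-Computational_Algebra.Computational_Algebra"
    "HOL-Library.Landau_Symbols"
begin

text \<open>
  Meromorphic functions on the plane are represented by total functions
  \<open>complex \<Rightarrow> complex\<close> normalised as in \<open>nicely_meromorphic_on\<close>: the value is 0 at a pole and the
  limit elsewhere. Under this convention, equality of functions is the identity of meromorphic
  functions.
\<close>

definition entire_finite_order :: "(complex \<Rightarrow> complex) \<Rightarrow> bool" where
  "entire_finite_order f \<longleftrightarrow>
     f holomorphic_on UNIV \<and>
     (\<exists>\<rho>::real. (\<lambda>s. norm (f s)) \<in> O[at_infinity](\<lambda>s. exp (norm s powr \<rho>)))"

definition completed_L ::
  "(complex \<Rightarrow> complex) \<Rightarrow> real \<Rightarrow> nat \<Rightarrow> (nat \<Rightarrow> real) \<Rightarrow> (nat \<Rightarrow> complex) \<Rightarrow> complex \<Rightarrow> complex" where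
  "completed_L L Q K lam mu s =
     L s * of_real Q powr s * (\<Prod>j=1..K. Gamma (of_real (lam j) * s + mu j))"

text \<open>
  The value \<open>a 0\<close> plays no role. The functional equation is an identity of meromorphic functions;
  as \<open>Gamma\<close> and \<open>L\<close> take the value 0 at their poles, it is required only off a set without
  accumulation points.
\<close>

definition extended_Selberg :: "(complex \<Rightarrow> complex) set" where
  "extended_Selberg = {L.
     L nicely_meromorphic_on UNIV \<and>
     (\<exists>a :: nat \<Rightarrow> complex.
        a 1 = 1 \<and>
        (\<forall>\<epsilon>>0. (\<lambda>n. norm (a n)) \<in> O(\<lambda>n. real n powr \<epsilon>)) \<and>
        (\<forall>s. Re s > 1 \<longrightarrow> (\<lambda>n. a (Suc n) / of_nat (Suc n) powr s) sums L s)) \<and>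
     (\<exists>k F. entire_finite_order F \<and> (\<forall>s. s \<noteq> 1 \<longrightarrow> F s = (s - 1) ^ k * L s)) \<and>
     (\<exists>Q K lam mu \<omega>.
        Q > 0 \<and> (\<forall>j\<in>{1..K}. lam j > 0 \<and> Re (mu j) \<ge> 0) \<and> norm \<omega> = 1 \<and>
        (\<forall>\<^sub>\<approx>s. completed_L L Q K lam mu s = \<omega> * cnj (completed_L L Q K lam mu (1 - cnj s))))}"

text \<open>
  Taking the fraction in lowest terms makes the value 0 at exactly the poles, in accordance with
  the normalisation above (for instance, \<open>s / s\<close> is ruled out as a representation of 1).
\<close>

definition rational_function :: "(complex \<Rightarrow> complex) \<Rightarrow> bool" where
  "rational_function h \<longleftrightarrow>
     (\<exists>p q :: complex poly. q \<noteq> 0 \<and> coprime p q \<and> h = (\<lambda>s. poly p s / poly q s))"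

text \<open>
  Both \<open>isolated_zero\<close> and \<open>zorder\<close> depend only on the values of \<open>f\<close> in a punctured neighbourhood
  of \<open>z\<close>. Hence they also treat correctly a difference of two functions whose poles at \<open>z\<close> cancel,
  where its pointwise value need not be the limit.
\<close>

definition zero_of_multiplicity :: "(complex \<Rightarrow> complex) \<Rightarrow> complex \<Rightarrow> nat \<Rightarrow> bool" where
  "zero_of_multiplicity f z m \<longleftrightarrow> isolated_zero f z \<and> zorder f z = int m"

definition same_zeros_with_multiplicity :: "(complex \<Rightarrow> complex) \<Rightarrow> (complex \<Rightarrow> complex) \<Rightarrow> bool" where
  "same_zeros_with_multiplicity f g \<longleftrightarrow>
     (\<forall>z m. zero_of_multiplicity f z m \<longleftrightarrow> zero_of_multiplicity g z m)"

end

theory Submission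
  imports Defs
begin

text \<open>
  Write \<open>h = p / q\<close>. The entire functions of finite order obtained from \<open>L1 - h\<close> and \<open>L2 - h\<close> by
  clearing denominators have the same zeros off a finite set, so
  \<open>U * (L1 - h) = exp g * V * (L2 - h)\<close> with polynomials \<open>U\<close>, \<open>V\<close> and \<open>g\<close>. Since \<open>L1 - 1\<close> and
  \<open>L2 - 1\<close> decay like \<open>2 powr (- Re s)\<close>, whereas \<open>1 - h\<close>, not being identically zero, decays at most
  polynomially, \<open>(L1 - h) / (L2 - h)\<close> tends to 1 exponentially fast along every horizontal line.
  Hence \<open>exp (g (x + \<tau>) - g x)\<close> tends to 1 for every \<open>\<tau>\<close>, which forces \<open>g\<close> to be constant, and then
  the polynomial \<open>exp g * V - U\<close> tends to 0 and therefore vanishes.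
\<close>

section \<open>Entire functions of finite order\<close>

text \<open>Finite order, encoded as a bound on the whole plane with a natural exponent. As the base
  \<open>1 + norm z\<close> is at least 1, exponents can be raised freely when bounds are
  combined.\<close>

definition exp_poly_bounded :: "(complex \<Rightarrow> complex) \<Rightarrow> bool" where
  "exp_poly_bounded f \<longleftrightarrow> (\<exists>C\<ge>0. \<exists>n. \<forall>z. norm (f z) \<le> exp (C * (1 + norm z) ^ n))"

lemma exp_poly_boundedI:
  assumes "C \<ge> 0" "\<And>z. norm (f z) \<le> exp (C * (1 + norm z) ^ n)"
  shows "exp_poly_bounded f"
  using assms unfolding exp_poly_bounded_def by blast

section \<open>Closure properties of the growth class\<close>

lemma exp_poly_bounded_mult:
  assumes "exp_poly_bounded f" "exp_poly_bounded g"
  shows "exp_poly_bounded (\<lambda>z. f z * g z)"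
proof -
  obtain C m where C: "C \<ge> 0" "\<And>z. norm (f z) \<le> exp (C * (1 + norm z) ^ m)"
    using assms(1) unfolding exp_poly_bounded_def by blast
  obtain D n where D: "D \<ge> 0" "\<And>z. norm (g z) \<le> exp (D * (1 + norm z) ^ n)"
    using assms(2) unfolding exp_poly_bounded_def by blast
  show ?thesis
  proof (rule exp_poly_boundedI)
    show "C + D \<ge> 0" using C D by simp
    fix z :: complex
    have "norm (f z * g z) \<le> exp (C * (1 + norm z) ^ m) * exp (D * (1 + norm z) ^ n)"
      unfolding norm_mult using C D by (intro mult_mono) auto
    also have "\<dots> = exp (C * (1 + norm z) ^ m + D * (1 + norm z) ^ n)"
      by (simp add: exp_add)
    also have "C * (1 + norm z) ^ m + D * (1 + norm z) ^ n \<le>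
        C * (1 + norm z) ^ (m + n) + D * (1 + norm z) ^ (m + n)"
      using C D by (intro add_mono mult_left_mono power_increasing) auto
    finally show "norm (f z * g z) \<le> exp ((C + D) * (1 + norm z) ^ (m + n))"
      by (simp add: algebra_simps)
  qed
qed

lemma exp_poly_bounded_add:
  assumes "exp_poly_bounded f" "exp_poly_bounded g"
  shows "exp_poly_bounded (\<lambda>z. f z + g z)"
proof -
  obtain C m where C: "C \<ge> 0" "\<And>z. norm (f z) \<le> exp (C * (1 + norm z) ^ m)"
    using assms(1) unfolding exp_poly_bounded_def by blast
  obtain D n where D: "D \<ge> 0" "\<And>z. norm (g z) \<le> exp (D * (1 + norm z) ^ n)"
    using assms(2) unfolding exp_poly_bounded_def by blast
  show ?thesis
  proof (rule exp_poly_boundedI)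
    \<comment> \<open>The extra 1 absorbs the factor 2 of the triangle inequality: 2 is at most
      \<open>exp 1\<close>, and \<open>?T \<ge> 1\<close>.\<close>
    show "C + D + 1 \<ge> 0" using C D by simp
    fix z :: complex
    let ?T = "(1 + norm z) ^ (m + n)"
    have T: "?T \<ge> 1" by simp
    have "C * (1 + norm z) ^ m \<le> C * ?T" "D * (1 + norm z) ^ n \<le> D * ?T"
      using C D by (intro mult_left_mono power_increasing; simp)+
    then have "norm (f z) \<le> exp ((C + D) * ?T)" "norm (g z) \<le> exp ((C + D) * ?T)"
      using C D T by (auto intro!: order.trans[OF C(2)] order.trans[OF D(2)] simp: algebra_simps
          intro: add_increasing add_increasing2)
    then have "norm (f z + g z) \<le> 2 * exp ((C + D) * ?T)"
      by norm
    also have "\<dots> \<le> exp 1 * exp ((C + D) * ?T)"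
      using exp_ge_add_one_self[of 1] by (intro mult_right_mono) auto
    also have "\<dots> = exp (1 + (C + D) * ?T)" by (simp add: exp_add)
    also have "\<dots> \<le> exp ((C + D + 1) * ?T)" using T by (simp add: algebra_simps)
    finally show "norm (f z + g z) \<le> exp ((C + D + 1) * ?T)" .
  qed
qed

lemma exp_poly_bounded_const: "exp_poly_bounded (\<lambda>_. c)"
  by (intro exp_poly_boundedI[where C = "norm c" and n = 0])
     (auto intro!: order.trans[OF _ exp_ge_add_one_self])

lemma exp_poly_bounded_ident: "exp_poly_bounded (\<lambda>z. z)"
  by (intro exp_poly_boundedI[where C = 1 and n = 1])
     (auto intro!: order.trans[OF _ exp_ge_add_one_self])

lemma exp_poly_bounded_poly: "exp_poly_bounded (poly p)"
  by (induction p)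
     (auto intro!: exp_poly_bounded_add exp_poly_bounded_mult exp_poly_bounded_const
       exp_poly_bounded_ident)

text \<open>Rests on \<open>1 + norm (c + z) \<le> (1 + norm c) * (1 + norm z)\<close>. It serves to
  move the origin to a point where a given function does not vanish.\<close>

lemma exp_poly_bounded_translate:
  assumes "exp_poly_bounded f"
  shows "exp_poly_bounded (\<lambda>z. f (c + z))"
proof -
  obtain C n where C: "C \<ge> 0" "\<And>z. norm (f z) \<le> exp (C * (1 + norm z) ^ n)"
    using assms(1) unfolding exp_poly_bounded_def by blast
  show ?thesis
  proof (rule exp_poly_boundedI)
    show "C * (1 + norm c) ^ n \<ge> 0" using C by simp
    fix z
    have "1 + norm (c + z) \<le> 1 + norm c + norm z" using norm_triangle_ineq[of c z] by simp
    also have "\<dots> \<le> (1 + norm c) * (1 + norm z)" by (simp add: algebra_simps)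
    finally have "(1 + norm (c + z)) ^ n \<le> (1 + norm c) ^ n * (1 + norm z) ^ n"
      unfolding power_mult_distrib[symmetric] by (intro power_mono) auto
    then have "C * (1 + norm (c + z)) ^ n \<le> C * ((1 + norm c) ^ n * (1 + norm z) ^ n)"
      using C by (intro mult_left_mono)
    then show "norm (f (c + z)) \<le> exp (C * (1 + norm c) ^ n * (1 + norm z) ^ n)"
      by (intro order.trans[OF C(2)]) (simp add: mult.assoc)
  qed
qed

lemma entire_finite_order_imp_exp_poly_bounded:
  assumes "entire_finite_order f"
  shows "exp_poly_bounded f"
proof -
  obtain \<rho> :: real where hol: "f holomorphic_on UNIV"
    and "(\<lambda>s. norm (f s)) \<in> O[at_infinity](\<lambda>s. exp (norm s powr \<rho>))"
    using assms unfolding entire_finite_order_def by blast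
  then obtain c where c: "c > 0"
    and "eventually (\<lambda>s. norm (f s) \<le> c * exp (norm s powr \<rho>)) at_infinity"
    by (elim landau_o.bigE) auto
  then obtain R where R: "\<And>s. norm s \<ge> R \<Longrightarrow> norm (f s) \<le> c * exp (norm s powr \<rho>)"
    unfolding eventually_at_infinity by blast
  \<comment> \<open>Inside this disc compactness gives a bound, outside it the Landau bound applies.
    The radius is at least 1 so that \<open>norm s powr \<rho>\<close> does not decrease when \<rho>
    is replaced by the natural number \<open>n\<close>.\<close>
  have "compact (f ` cball 0 (max R 1))"
    using hol by (intro compact_continuous_image holomorphic_on_imp_continuous_on
        holomorphic_on_subset[OF hol]) auto
  then obtain K where K: "K > 0" "\<And>s. norm s \<le> max R 1 \<Longrightarrow> norm (f s) \<le> K"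
    unfolding bounded_pos[of "f ` cball 0 (max R 1)"] by (auto dest!: compact_imp_bounded simp: bounded_pos)
  define n where "n = nat \<lceil>\<rho>\<rceil>"
  show ?thesis
  proof (rule exp_poly_boundedI)
    show "c + 1 + K \<ge> 0" using c K by simp
    fix s :: complex
    let ?T = "(1 + norm s) ^ n"
    have T: "?T \<ge> 1" by simp
    show "norm (f s) \<le> exp ((c + 1 + K) * ?T)"
    proof (cases "norm s \<le> max R 1")
      case True
      have "norm (f s) \<le> K" using K True by simp
      also have "K \<le> exp K" by (rule order.trans[OF _ exp_ge_add_one_self]) simp
      also have "\<dots> \<le> exp ((c + 1 + K) * ?T)"
        using T c K mult_mono[of K "c + 1 + K" 1 ?T] by simp
      finally show ?thesis .
    next
      case False
      then have s: "norm s \<ge> R" "norm s \<ge> 1" by auto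
      have "norm s powr \<rho> \<le> norm s powr real n"
        using s by (intro powr_mono) (auto simp: n_def real_nat_ceiling_ge)
      also have "\<dots> = norm s ^ n" using s by (subst powr_realpow) auto
      also have "\<dots> \<le> ?T" by (intro power_mono) auto
      finally have "norm s powr \<rho> \<le> ?T" .
      have "norm (f s) \<le> c * exp (norm s powr \<rho>)" using R s by simp
      also have "\<dots> \<le> exp c * exp ?T"
        using \<open>norm s powr \<rho> \<le> ?T\<close> c
        by (intro mult_mono order.trans[OF _ exp_ge_add_one_self[of c]]) auto
      also have "\<dots> = exp (c + ?T)" by (simp add: exp_add)
      also have "c + ?T \<le> (c + 1 + K) * ?T"
      proof -
        have "c \<le> c * ?T" using mult_left_mono[OF T, of c] c by linarith
        moreover have "0 \<le> K * ?T" using K by simp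
        ultimately show ?thesis by (simp add: algebra_simps)
      qed
      finally show ?thesis by simp
    qed
  qed
qed

text \<open>Points with \<open>Re u < T\<close> are closer to 0 than to its mirror image
  \<open>2 * T\<close>, so \<open>u / (2 * T - u)\<close> maps this half plane into the unit disc
  and fixes 0. The Schwarz lemma at modulus at most 1/2 gives
  \<open>norm u \<le> (2 * T + norm u) / 2\<close>, which is solved for
  \<open>norm u\<close>.\<close>

lemma Borel_Caratheodory_half:
  fixes f :: "complex \<Rightarrow> complex"
  assumes hol: "f holomorphic_on ball 0 R" and R: "R > 0"
    and bd: "\<And>z. norm z < R \<Longrightarrow> Re (f z) < S" and z: "norm z \<le> R / 2"
  shows "norm (f z - f 0) \<le> 2 * (S - Re (f 0))"
proof -
  define T where "T = S - Re (f 0)"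
  have T: "T > 0" using bd[of 0] R by (simp add: T_def)
  define u where "u = (\<lambda>w. f (of_real R * w) - f 0)"
  have u: "Re (u w) < T" if "norm w < 1" for w
    using bd[of "of_real R * w"] that R by (simp add: u_def T_def norm_mult)
  have nz: "2 * of_real T - u w \<noteq> 0" if "norm w < 1" for w
    using u[OF that] T by (auto simp: complex_eq_iff)
  have holu: "u holomorphic_on ball 0 1"
    unfolding u_def
    by (intro holomorphic_intros holomorphic_on_compose_gen[OF _ hol, unfolded o_def])
       (use R in \<open>auto simp: norm_mult\<close>)
  define v where "v = (\<lambda>w. u w / (2 * of_real T - u w))"
  have holv: "v holomorphic_on ball 0 1"
    unfolding v_def using nz by (intro holomorphic_intros holu) auto
  have less: "norm (v w) < 1" if "norm w < 1" for w
  proof -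
    have "(norm (u w))\<^sup>2 < (norm (2 * of_real T - u w))\<^sup>2"
      using u[OF that] T unfolding cmod_power2 by (simp add: power2_eq_square algebra_simps)
    then have "norm (u w) < norm (2 * of_real T - u w)"
      using power_less_imp_less_base norm_ge_zero by blast
    then show ?thesis
      using nz[OF that] by (simp add: v_def norm_divide divide_less_eq)
  qed
  define w where "w = z / of_real R"
  have w: "norm w \<le> 1 / 2" using z R by (simp add: w_def norm_divide field_simps)
  have "norm (v w) \<le> norm w"
    by (rule Schwarz_Lemma(1)[OF holv _ less]) (use w in \<open>auto simp: v_def u_def\<close>)
  with w have v: "norm (v w) \<le> 1 / 2" by simp
  have "norm (u w) \<le> 2 * T"
  proof -
    have nz': "norm (2 * of_real T - u w) > 0" using nz[of w] w by auto
    have "norm (u w) = norm (v w) * norm (2 * of_real T - u w)"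
      using nz' by (simp add: v_def norm_divide)
    also have "\<dots> \<le> 1 / 2 * (2 * T + norm (u w))"
      using v T norm_triangle_ineq4[of "2 * of_real T" "u w"] by (intro mult_mono) (auto simp: norm_mult)
    finally show ?thesis by simp
  qed
  moreover have "u w = f z - f 0" using R by (simp add: u_def w_def)
  ultimately show ?thesis by (simp add: T_def)
qed

text \<open>The quotient by \<open>(s - z) ^ m\<close> is holomorphic off \<open>z\<close> and
  agrees with \<open>zor_poly f z\<close> near \<open>z\<close>; the two open pieces cover the
  plane.\<close>

lemma entire_factor_zero:
  fixes f :: "complex \<Rightarrow> complex"
  assumes hol: "f holomorphic_on UNIV" and nz: "f w \<noteq> 0"
  obtains m g where "g holomorphic_on UNIV" "g z \<noteq> 0" "\<And>s. f s = (s - z) ^ m * g s"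
proof -
  obtain r where r: "r > 0" "zor_poly f z holomorphic_on cball z r"
    and eq: "\<And>w. w \<in> cball z r \<Longrightarrow> f w = zor_poly f z w * (w - z) ^ nat (zorder f z) \<and> zor_poly f z w \<noteq> 0"
    using zorder_exist_zero[OF hol] nz by blast
  define m where "m = nat (zorder f z)"
  define g where "g = (\<lambda>s. if s = z then zor_poly f z z else f s / (s - z) ^ m)"
  have "g holomorphic_on -{z}"
    by (rule holomorphic_transform[where f = "\<lambda>s. f s / (s - z) ^ m"])
       (auto intro!: holomorphic_intros holomorphic_on_subset[OF hol] simp: g_def)
  moreover have "g holomorphic_on ball z r"
    by (rule holomorphic_transform[where f = "zor_poly f z"])
       (use eq in \<open>auto intro!: holomorphic_on_subset[OF r(2)] simp: g_def m_def\<close>)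
  ultimately have "g holomorphic_on (-{z} \<union> ball z r)"
    by (intro holomorphic_on_Un) auto
  also have "-{z} \<union> ball z r = UNIV" using r by auto
  finally have "g holomorphic_on UNIV" .
  moreover have "g z \<noteq> 0" using eq[of z] r by (simp add: g_def)
  moreover have "f s = (s - z) ^ m * g s" for s
    using eq[of z] r by (auto simp: g_def m_def)
  ultimately show ?thesis by (rule that)
qed

text \<open>The points are divided out one at a time. \<open>Z\<close> may contain points where
  \<open>f\<close> does not vanish; their exponent is then 0.\<close>

lemma entire_factor_zeros:
  fixes f :: "complex \<Rightarrow> complex"
  assumes hol: "f holomorphic_on UNIV" and nz: "f w \<noteq> 0" and fin: "finite Z"
  obtains m g where "g holomorphic_on UNIV" "\<And>z. z \<in> Z \<Longrightarrow> g z \<noteq> 0"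
    "\<And>s. f s = (\<Prod>z\<in>Z. (s - z) ^ m z) * g s"
  using fin
proof (induction Z arbitrary: thesis)
  case empty
  show ?case by (rule empty(1)[OF hol]) auto
next
  case (insert a Z)
  obtain m g where g: "g holomorphic_on UNIV" "\<And>z. z \<in> Z \<Longrightarrow> g z \<noteq> 0"
    "\<And>s. f s = (\<Prod>z\<in>Z. (s - z) ^ m z) * g s"
    using insert.IH by blast
  have "g w \<noteq> 0" using g(3)[of w] nz by auto
  then obtain k h where h: "h holomorphic_on UNIV" "h a \<noteq> 0" "\<And>s. g s = (s - a) ^ k * h s"
    using entire_factor_zero[OF g(1)] by metis
  show ?case
  proof (rule insert.prems[OF h(1)])
    show "h z \<noteq> 0" if "z \<in> insert a Z" for z
      using that h(2) h(3)[of z] g(2)[of z] by auto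
    have "(\<Prod>z\<in>Z. (s - z) ^ (m(a := k)) z) = (\<Prod>z\<in>Z. (s - z) ^ m z)" for s
      by (rule prod.cong) (use insert.hyps in auto)
    then show "f s = (\<Prod>z\<in>insert a Z. (s - z) ^ (m(a := k)) z) * h s" for s
      using insert.hyps by (simp add: g(3)[of s] h(3)[of s])
  qed
qed

text \<open>
  On a disc of radius \<open>R\<close> the common zeros of \<open>E * g\<close> and \<open>g\<close> are divided out by a product of
  factors \<open>1 - s / z\<close>, which has modulus at least 1 on the circle of radius \<open>2 * R\<close>. The maximum
  principle bounds what remains of \<open>E * g\<close> from above, and Borel--Caratheodory for the logarithm
  bounds what remains of \<open>g\<close> from below.
\<close>

lemma norm_quotient_le_on_disc:
  fixes E g :: "complex \<Rightarrow> complex"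
  assumes holE: "E holomorphic_on UNIV" and holg: "g holomorphic_on UNIV" and g0: "g 0 \<noteq> 0"
    and E: "\<And>z. E z \<noteq> 0" and R: "R > 0"
    and bdg: "\<And>z. norm z = 2 * R \<Longrightarrow> norm (g z) \<le> exp S"
    and bdEg: "\<And>z. norm z = 2 * R \<Longrightarrow> norm (E z * g z) \<le> exp S"
    and w: "norm w \<le> R / 2"
  shows "norm (E w) \<le> exp (3 * S + 2 - 3 * ln (norm (g 0)))"
proof -
  define Z where "Z = {z \<in> cball 0 R. g z = 0}"
  have "finite Z"
  proof (cases "g constant_on UNIV")
    case True
    then have "Z = {}" using g0 by (auto simp: Z_def constant_on_def)
    then show ?thesis by simp
  next
    case False
    then show ?thesis
      unfolding Z_def by (intro holomorphic_compact_finite_zeros[OF holg open_UNIV]) auto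
  qed
  then obtain m G where G: "G holomorphic_on UNIV" "\<And>z. z \<in> Z \<Longrightarrow> G z \<noteq> 0"
    "\<And>s. g s = (\<Prod>z\<in>Z. (s - z) ^ m z) * G s"
    using entire_factor_zeros[OF holg g0] by metis
  have Z0: "0 \<notin> Z" using g0 by (auto simp: Z_def)
  \<comment> \<open>The factors \<open>1 - s / z\<close> are normalised so that
    \<open>p 0 = 1\<close> and hence \<open>H 0 = g 0\<close>; the constants \<open>- z\<close> go
    into \<open>H\<close>.\<close>
  define p where "p = (\<lambda>s. \<Prod>z\<in>Z. (1 - s / z) ^ m z)"
  define H where "H = (\<lambda>s. (\<Prod>z\<in>Z. (- z) ^ m z) * G s)"
  have holH: "H holomorphic_on UNIV" unfolding H_def by (intro holomorphic_intros G)
  have gpH: "g s = p s * H s" for s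
  proof -
    have "(\<Prod>z\<in>Z. (s - z) ^ m z) = (\<Prod>z\<in>Z. (1 - s / z) ^ m z * (- z) ^ m z)"
      by (rule prod.cong)
         (use Z0 in \<open>auto simp: power_mult_distrib[symmetric] algebra_simps\<close>)
    then show ?thesis by (simp add: G(3)[of s] p_def H_def prod.distrib)
  qed
  have p0: "p 0 = 1" by (simp add: p_def)
  have H0: "H 0 = g 0" using gpH[of 0] p0 by simp
  have H_nz: "H s \<noteq> 0" if "norm s \<le> R" for s
  proof (cases "s \<in> Z")
    case True
    then show ?thesis using G(2) Z0 \<open>finite Z\<close> by (auto simp: H_def)
  next
    case False
    then show ?thesis using that gpH[of s] by (auto simp: Z_def)
  qed
  have p_ge: "norm (p s) \<ge> 1" if s: "norm s = 2 * R" for s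
  proof -
    have "1 \<le> norm (1 - s / z)" if "z \<in> Z" for z
    proof -
      have z: "z \<noteq> 0" "norm z \<le> R" using that Z0 by (auto simp: Z_def)
      then have "2 \<le> norm (s / z)" using s by (simp add: norm_divide field_simps)
      then show ?thesis using norm_triangle_ineq3[of 1 "s / z"] by simp
    qed
    then show ?thesis by (simp add: p_def prod_norm[symmetric] norm_power prod_ge_1)
  qed
  have max: "norm (f s) \<le> exp S"
    if "f holomorphic_on UNIV" "\<And>s. norm s = 2 * R \<Longrightarrow> norm (p s * f s) \<le> exp S" "norm s \<le> 2 * R"
    for f s
  proof (rule maximum_modulus_frontier[of f "cball 0 (2 * R)"])
    show "continuous_on (closure (cball 0 (2 * R))) f"
      using that(1) holomorphic_on_imp_continuous_on holomorphic_on_subset by blast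
    fix z :: complex assume "z \<in> frontier (cball 0 (2 * R))"
    then have z: "norm z = 2 * R" using R by (simp add: frontier_cball)
    have "norm (f z) \<le> norm (p z) * norm (f z)"
      using p_ge[OF z] by (simp add: mult_le_cancel_right1)
    also have "\<dots> \<le> exp S" using that(2)[OF z] by (simp add: norm_mult)
    finally show "norm (f z) \<le> exp S" .
  qed (use that holomorphic_on_subset in auto)
  have upH: "norm (H s) \<le> exp S" if "norm s \<le> 2 * R" for s
    by (rule max[OF holH _ that]) (use bdg gpH in auto)
  have upEH: "norm (E s * H s) \<le> exp S" if "norm s \<le> 2 * R" for s
    by (rule max[OF _ _ that]) (use bdEg gpH in \<open>auto intro!: holomorphic_intros holH holE simp: mult_ac\<close>)
  obtain \<phi> where \<phi>: "\<phi> holomorphic_on ball 0 R" "\<And>s. s \<in> ball 0 R \<Longrightarrow> H s = exp (\<phi> s)"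
    by (rule contractible_imp_holomorphic_log[of H "ball 0 R"])
       (use H_nz in \<open>auto intro!: holomorphic_on_subset[OF holH] convex_imp_contractible\<close>)
  \<comment> \<open>The summand 1 supplies the strict inequality that Borel--Caratheodory asks
    for.\<close>
  have Re_less: "Re (\<phi> s) < S + 1" if "norm s < R" for s
  proof -
    have "exp (Re (\<phi> s)) = norm (H s)" using \<phi>(2)[of s] that by simp
    also have "\<dots> \<le> exp S" using that R by (intro upH) simp
    finally show ?thesis by simp
  qed
  have Re0: "Re (\<phi> 0) = ln (norm (g 0))"
    using \<phi>(2)[of 0] R H0 g0 by simp
  have wR: "norm w < R" using w R by simp
  have "norm (\<phi> w - \<phi> 0) \<le> 2 * (S + 1 - Re (\<phi> 0))"
    by (rule Borel_Caratheodory_half[OF \<phi>(1) R Re_less w])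
  then have "- (Re (\<phi> w) - Re (\<phi> 0)) \<le> 2 * (S + 1 - Re (\<phi> 0))"
    using abs_Re_le_cmod[of "\<phi> w - \<phi> 0"] by simp
  \<comment> \<open>The right-hand side is
    \<open>2 * (S + 1 - Re (\<phi> 0)) - Re (\<phi> 0)\<close>. Dividing \<open>exp S\<close> by
    \<open>norm (H w) = exp (Re (\<phi> w))\<close> adds the third \<open>S\<close>.\<close>
  then have Re_ge: "- Re (\<phi> w) \<le> 2 * S + 2 - 3 * ln (norm (g 0))" using Re0 by simp
  have "norm (E w) * exp (Re (\<phi> w)) \<le> exp S"
    using upEH[of w] \<phi>(2)[of w] wR R by (simp add: norm_mult)
  then have "norm (E w) \<le> exp S * exp (- Re (\<phi> w))"
    by (simp add: exp_minus field_simps)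
  also have "\<dots> = exp (S + - Re (\<phi> w))" by (simp only: exp_add)
  also have "\<dots> \<le> exp (3 * S + 2 - 3 * ln (norm (g 0)))" using Re_ge by simp
  finally show ?thesis .
qed

text \<open>After a shift taking \<open>c\<close> to the origin, the disc estimate is applied at
  every \<open>w\<close>, with a radius that grows linearly in \<open>norm w\<close>.\<close>

lemma exp_poly_bounded_quotient:
  fixes E g :: "complex \<Rightarrow> complex"
  assumes holE: "E holomorphic_on UNIV" and holg: "g holomorphic_on UNIV" and gc: "g c \<noteq> 0"
    and E: "\<And>z. E z \<noteq> 0"
    and "exp_poly_bounded g" "exp_poly_bounded (\<lambda>z. E z * g z)"
  shows "exp_poly_bounded E"
proof -
  define E' where "E' = (\<lambda>z. E (c + z))"
  define g' where "g' = (\<lambda>z. g (c + z))"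
  have hol': "E' holomorphic_on UNIV" "g' holomorphic_on UNIV"
    unfolding E'_def g'_def
    by (auto intro!: holomorphic_intros holomorphic_on_compose_gen[OF _ holE, unfolded o_def]
        holomorphic_on_compose_gen[OF _ holg, unfolded o_def])
  obtain C m where C: "C \<ge> 0" "\<And>z. norm (g' z) \<le> exp (C * (1 + norm z) ^ m)"
    using exp_poly_bounded_translate[OF assms(5)] unfolding exp_poly_bounded_def g'_def by blast
  obtain D n where D: "D \<ge> 0" "\<And>z. norm (E' z * g' z) \<le> exp (D * (1 + norm z) ^ n)"
    using exp_poly_bounded_translate[OF assms(6), of c]
    unfolding exp_poly_bounded_def g'_def E'_def by blast
  define l where "l = \<bar>ln (norm (g' 0))\<bar>"
  define B where "B = 3 * ((C + D) * 4 ^ (m + n)) + 2 + 3 * l"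
  have "exp_poly_bounded E'"
  proof (rule exp_poly_boundedI)
    show "B \<ge> 0" using C D by (simp add: B_def l_def)
    fix w :: complex
    \<comment> \<open>This radius satisfies \<open>norm w \<le> R / 2\<close>, stays positive at
      \<open>w = 0\<close>, and gives \<open>1 + 2 * R \<le> 4 * (1 + norm w)\<close>, the source of
      \<open>4 ^ (m + n)\<close> in \<open>B\<close>.\<close>
    define R where "R = 2 * norm w + 1"
    define S where "S = (C + D) * (1 + 2 * R) ^ (m + n)"
    have R: "R > 0" by (simp add: R_def add_nonneg_pos)
    have "norm (E' w) \<le> exp (3 * S + 2 - 3 * ln (norm (g' 0)))"
    proof (rule norm_quotient_le_on_disc[OF hol' _ _ R])
      show "norm w \<le> R / 2" by (simp add: R_def)
      show "norm (g' z) \<le> exp S" if z: "norm z = 2 * R" for z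
      proof (rule order.trans[OF C(2)])
        have "C * (1 + norm z) ^ m \<le> (C + D) * (1 + norm z) ^ (m + n)"
          using C D by (intro mult_mono power_increasing) auto
        then show "exp (C * (1 + norm z) ^ m) \<le> exp S" by (simp add: S_def z)
      qed
      show "norm (E' z * g' z) \<le> exp S" if z: "norm z = 2 * R" for z
      proof (rule order.trans[OF D(2)])
        have "D * (1 + norm z) ^ n \<le> (C + D) * (1 + norm z) ^ (m + n)"
          using C D by (intro mult_mono power_increasing) auto
        then show "exp (D * (1 + norm z) ^ n) \<le> exp S" by (simp add: S_def z)
      qed
    qed (use gc E in \<open>auto simp: g'_def E'_def\<close>)
    also have "3 * S + 2 - 3 * ln (norm (g' 0)) \<le> B * (1 + norm w) ^ (m + n)"
    proof -
      let ?T = "(1 + norm w) ^ (m + n)"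
      have T: "?T \<ge> 1" by simp
      have "(1 + 2 * R) ^ (m + n) \<le> (4 * (1 + norm w)) ^ (m + n)"
        by (intro power_mono) (auto simp: R_def)
      then have "S \<le> (C + D) * (4 ^ (m + n) * ?T)"
        unfolding S_def power_mult_distrib using C D by (intro mult_left_mono) auto
      moreover have "2 + 3 * l \<le> (2 + 3 * l) * ?T"
        using T mult_left_mono[of 1 ?T "2 + 3 * l"] by (simp add: l_def)
      moreover have "- ln (norm (g' 0)) \<le> l" by (simp add: l_def)
      ultimately have "3 * S + 2 - 3 * ln (norm (g' 0)) \<le>
          3 * ((C + D) * (4 ^ (m + n) * ?T)) + (2 + 3 * l) * ?T"
        by linarith
      also have "\<dots> = B * ?T" by (simp add: B_def algebra_simps)
      finally show ?thesis .
    qed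
    finally show "norm (E' w) \<le> exp (B * (1 + norm w) ^ (m + n))" by simp
  qed
  from exp_poly_bounded_translate[OF this, of "- c"] show ?thesis by (simp add: E'_def)
qed

text \<open>The real part of a holomorphic logarithm of \<open>E\<close> is bounded above
  polynomially. Borel--Caratheodory carries this over to its modulus, and an entire function of
  polynomial growth is a polynomial.\<close>

lemma exp_poly_bounded_nonvanishing:
  fixes E :: "complex \<Rightarrow> complex"
  assumes hol: "E holomorphic_on UNIV" and nz: "\<And>z. E z \<noteq> 0" and bd: "exp_poly_bounded E"
  obtains p where "\<And>z. E z = exp (poly p z)"
proof -
  obtain g where g: "g holomorphic_on UNIV" "\<And>z. E z = exp (g z)"
    by (rule contractible_imp_holomorphic_log[OF hol]) (use nz in auto)
  obtain C n where C: "C \<ge> 0" "\<And>z. norm (E z) \<le> exp (C * (1 + norm z) ^ n)"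
    using bd unfolding exp_poly_bounded_def by blast
  have Re_le: "Re (g z) \<le> C * (1 + norm z) ^ n" for z
    using C(2)[of z] by (simp add: g(2))
  define B where "B = 2 * (C * 3 ^ n + 1 + norm (g 0)) + norm (g 0)"
  have "norm (g z) \<le> B * norm z ^ n" if z: "norm z \<ge> 1" for z
  proof -
    \<comment> \<open>If \<open>norm w < 2 * norm z\<close> and \<open>norm z \<ge> 1\<close>, then
      \<open>1 + norm w \<le> 3 * norm z\<close>, so \<open>X\<close> bounds the real part on the
      disc of radius \<open>2 * norm z\<close>. \<open>Y\<close> dominates the remaining
      constants.\<close>
    define X where "X = C * (3 * norm z) ^ n"
    define Y where "Y = (2 + 3 * norm (g 0)) * norm z ^ n"
    have "norm (g z - g 0) \<le> 2 * (X + 1 - Re (g 0))"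
    proof (rule Borel_Caratheodory_half[of _ "2 * norm z"])
      show "Re (g w) < X + 1" if "norm w < 2 * norm z" for w
      proof -
        have "Re (g w) \<le> C * (1 + norm w) ^ n" by (rule Re_le)
        also have "\<dots> \<le> X"
          unfolding X_def using that z C by (intro mult_left_mono power_mono) auto
        finally show ?thesis by simp
      qed
    qed (use z holomorphic_on_subset[OF g(1)] in auto)
    moreover have "norm (g z) \<le> norm (g z - g 0) + norm (g 0)"
      using norm_triangle_ineq2[of "g z" "g 0"] by simp
    moreover have "- Re (g 0) \<le> norm (g 0)" using abs_Re_le_cmod[of "g 0"] by simp
    moreover have "2 + 3 * norm (g 0) \<le> Y"
      using z mult_left_mono[of 1 "norm z ^ n" "2 + 3 * norm (g 0)"] by (simp add: Y_def)
    ultimately have "norm (g z) \<le> 2 * X + Y" by (smt (verit))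
    also have "\<dots> = B * norm z ^ n"
      by (simp add: B_def X_def Y_def algebra_simps power_mult_distrib)
    finally show ?thesis .
  qed
  from Liouville_polynomial[OF g(1) this]
  have "g z = (\<Sum>k\<le>n. (deriv ^^ k) g 0 / fact k * z ^ k)" for z by blast
  then have "E z = exp (poly (\<Sum>k\<le>n. monom ((deriv ^^ k) g 0 / fact k) k) z)" for z
    by (simp add: g(2) poly_sum poly_monom)
  then show ?thesis by (rule that)
qed

section \<open>Behaviour along horizontal lines\<close>

text \<open>The offset \<tau> is complex throughout: its imaginary part selects the line, its real
  part shifts the parameter.\<close>

lemma filterlim_horizontal_at_infinity:
  "filterlim (\<lambda>x. of_real x + \<tau> :: complex) at_infinity at_top"
  by (rule tendsto_add_filterlim_at_infinity'[OF filterlim_of_real_at_infinity tendsto_const])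

lemma eventually_Re_horizontal_ge: "eventually (\<lambda>x. Re (of_real x + \<tau>) \<ge> c) at_top"
  using eventually_ge_at_top[of "c - Re \<tau>"] by eventually_elim simp

lemma poly_eventually_nonzero_horizontal:
  fixes p :: "complex poly"
  assumes "p \<noteq> 0"
  shows "eventually (\<lambda>x. poly p (of_real x + \<tau>) \<noteq> 0) at_top"
proof -
  have "finite {z. poly p z = 0}" using assms by (rule poly_roots_finite)
  then obtain B where B: "\<And>z. poly p z = 0 \<Longrightarrow> norm z \<le> B"
    using finite_imp_bounded[of "{z. poly p z = 0}"] unfolding bounded_iff by blast
  have "eventually (\<lambda>x. Re (of_real x + \<tau>) \<ge> B + 1) at_top" by (rule eventually_Re_horizontal_ge)
  then show ?thesis
  proof eventually_elim
    case (elim x)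
    show ?case
    proof
      assume "poly p (of_real x + \<tau>) = 0"
      then have "norm (of_real x + \<tau>) \<le> B" by (rule B)
      with elim complex_Re_le_cmod[of "of_real x + \<tau>"] show False by linarith
    qed
  qed
qed

lemma tendsto_poly_over_power_horizontal:
  fixes p :: "complex poly"
  shows "((\<lambda>x. poly p (of_real x + \<tau>) / (of_real x + \<tau>) ^ degree p) \<longlongrightarrow> lead_coeff p) at_top"
  by (rule filterlim_compose[OF poly_divide_tendsto_aux filterlim_horizontal_at_infinity])

lemma eventually_horizontal_nonzero: "eventually (\<lambda>x. of_real x + \<tau> \<noteq> (0 :: complex)) at_top"
  using poly_eventually_nonzero_horizontal[of "[:0, 1:]" \<tau>] by simp

text \<open>Both values are asymptotic to their leading terms, and
  \<open>(1 + \<tau> / x) ^ n\<close> tends to 1. Polynomial factors thus disappear when a function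
  is compared with its shift.\<close>

lemma tendsto_poly_shift_ratio:
  fixes p :: "complex poly"
  assumes "p \<noteq> 0"
  shows "((\<lambda>x. poly p (of_real x + \<tau>) / poly p (of_real x)) \<longlongrightarrow> 1) at_top"
proof -
  let ?n = "degree p"
  let ?l = "lead_coeff p"
  have inv: "((\<lambda>x. inverse (of_real x :: complex)) \<longlongrightarrow> 0) at_top"
    using filterlim_compose[OF tendsto_inverse_0 filterlim_horizontal_at_infinity[of 0]] by simp
  have "((\<lambda>x. (poly p (of_real x + \<tau>) / (of_real x + \<tau>) ^ ?n) /
          (poly p (of_real x + 0) / (of_real x + 0) ^ ?n) * (1 + \<tau> * inverse (of_real x)) ^ ?n)
        \<longlongrightarrow> ?l / ?l * (1 + \<tau> * 0) ^ ?n) at_top"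
    using assms by (intro tendsto_intros tendsto_poly_over_power_horizontal inv) auto
  then have lim: "((\<lambda>x. (poly p (of_real x + \<tau>) / (of_real x + \<tau>) ^ ?n) /
          (poly p (of_real x + 0) / (of_real x + 0) ^ ?n) * (1 + \<tau> * inverse (of_real x)) ^ ?n)
        \<longlongrightarrow> 1) at_top"
    using assms by simp
  show ?thesis
  proof (rule Lim_transform_eventually[OF lim])
    show "eventually (\<lambda>x. (poly p (of_real x + \<tau>) / (of_real x + \<tau>) ^ ?n) /
          (poly p (of_real x + 0) / (of_real x + 0) ^ ?n) * (1 + \<tau> * inverse (of_real x)) ^ ?n
        = poly p (of_real x + \<tau>) / poly p (of_real x)) at_top"
      using eventually_horizontal_nonzero[of 0] eventually_horizontal_nonzero[of \<tau>]
    proof eventually_elim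
      case (elim x)
      have "1 + \<tau> * inverse (of_real x) = (of_real x + \<tau>) / of_real x"
        using elim by (simp add: field_simps)
      then show ?case using elim by (simp add: power_divide)
    qed
  qed
qed

text \<open>Finiteness of the limit is the point: a null function stays null after division by
  \<open>p\<close>. In the witness \<open>0 ^ 0 = 1\<close> takes care of constant
  \<open>p\<close>.\<close>

lemma tendsto_inverse_poly_horizontal:
  fixes p :: "complex poly"
  assumes "p \<noteq> 0"
  shows "\<exists>c. ((\<lambda>x. inverse (poly p (of_real x + \<tau>))) \<longlongrightarrow> c) at_top"
proof -
  let ?n = "degree p"
  have inv: "((\<lambda>x. inverse (of_real x + \<tau>)) \<longlongrightarrow> 0) at_top"
    by (rule filterlim_compose[OF tendsto_inverse_0 filterlim_horizontal_at_infinity])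
  have lim: "((\<lambda>x. inverse (poly p (of_real x + \<tau>) / (of_real x + \<tau>) ^ ?n) *
      inverse (of_real x + \<tau>) ^ ?n) \<longlongrightarrow> inverse (lead_coeff p) * 0 ^ ?n) at_top"
    using assms by (intro tendsto_intros tendsto_poly_over_power_horizontal inv) auto
  have "((\<lambda>x. inverse (poly p (of_real x + \<tau>))) \<longlongrightarrow> inverse (lead_coeff p) * 0 ^ ?n) at_top"
    by (rule Lim_transform_eventually[OF lim],
        rule eventually_mono[OF eventually_horizontal_nonzero[of \<tau>]])
       (simp add: field_simps)
  then show ?thesis by blast
qed

lemma tendsto_power_times_exp_decay:
  "((\<lambda>x::real. x ^ k * 2 powr (- x)) \<longlongrightarrow> 0) at_top"
proof -
  have "filterlim (\<lambda>x::real. x * ln 2) at_top at_top"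
    by (rule filterlim_at_top_mult_tendsto_pos[OF tendsto_const _ filterlim_ident, of "ln 2"]) simp
  from filterlim_compose[OF tendsto_power_div_exp_0[of k] this]
  have "((\<lambda>x::real. inverse (ln 2) ^ k * ((x * ln 2) ^ k / exp (x * ln 2))) \<longlongrightarrow> inverse (ln 2) ^ k * 0) at_top"
    by (intro tendsto_intros)
  moreover have "inverse (ln 2) ^ k * ((x * ln 2) ^ k / exp (x * ln 2)) = x ^ k * 2 powr (- x)" for x :: real
    by (simp add: powr_def exp_minus field_simps)
  ultimately show ?thesis by simp
qed

text \<open>The power \<open>x ^ k\<close> is carried for the induction: of the new factor
  \<open>of_real x + \<tau>\<close>, the summand \<open>x\<close> raises \<open>k\<close> by one and
  \<tau> is a constant.\<close>

lemma tendsto_poly_times_exp_decay: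
  fixes p :: "complex poly"
  shows "((\<lambda>x. of_real (x ^ k * 2 powr (- x)) * poly p (of_real x + \<tau>)) \<longlongrightarrow> 0) at_top"
proof (induction p arbitrary: k)
  case 0
  show ?case by simp
next
  case (pCons a p)
  have base: "((\<lambda>x::real. x ^ k * 2 powr (- x)) \<longlongrightarrow> 0) at_top"
    by (rule tendsto_power_times_exp_decay)
  then have "((\<lambda>x. of_real (x ^ k * 2 powr (- x)) * a + (of_real (x ^ Suc k * 2 powr (- x)) * poly p (of_real x + \<tau>)
       + \<tau> * (of_real (x ^ k * 2 powr (- x)) * poly p (of_real x + \<tau>)))) \<longlongrightarrow> of_real 0 * a + (0 + \<tau> * 0)) at_top"
    by (intro tendsto_intros pCons.IH) 
  then show ?case by (simp add: algebra_simps)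
qed

lemma tendsto_poly_times_decaying:
  fixes p :: "complex poly"
  assumes "\<And>s. Re s \<ge> c \<Longrightarrow> norm (f s) \<le> K * 2 powr (- Re s)"
  shows "((\<lambda>x. poly p (of_real x + \<tau>) * f (of_real x + \<tau>)) \<longlongrightarrow> 0) at_top"
proof (rule Lim_null_comparison)
  let ?g = "\<lambda>x. of_real (x ^ 0 * 2 powr (- x)) * poly p (of_real x + \<tau>)"
  have "((\<lambda>x. K * 2 powr (- Re \<tau>) * norm (?g x)) \<longlongrightarrow> K * 2 powr (- Re \<tau>) * norm (0 :: complex)) at_top"
    by (intro tendsto_intros tendsto_poly_times_exp_decay)
  then show "((\<lambda>x. K * 2 powr (- Re \<tau>) * norm (?g x)) \<longlongrightarrow> 0) at_top" by simp
  show "eventually (\<lambda>x. norm (poly p (of_real x + \<tau>) * f (of_real x + \<tau>)) \<le> K * 2 powr (- Re \<tau>) * norm (?g x)) at_top"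
    using eventually_Re_horizontal_ge[of c \<tau>]
  proof eventually_elim
    case (elim x)
    have "norm (poly p (of_real x + \<tau>)) * norm (f (of_real x + \<tau>)) \<le>
        norm (poly p (of_real x + \<tau>)) * (K * 2 powr (- Re (of_real x + \<tau>)))"
      by (intro mult_left_mono assms elim) auto
    also have "2 powr (- Re (of_real x + \<tau>)) = 2 powr (- x) * 2 powr (- Re \<tau>)"
      by (simp add: powr_add[symmetric])
    finally show ?case by (simp add: norm_mult mult_ac)
  qed
qed

text \<open>Otherwise \<open>1 / p\<close> has a finite limit, and \<open>p * (1 / p) = 1\<close>
  would tend to 0.\<close>

lemma poly_zero_if_tendsto_zero_horizontal:
  fixes p :: "complex poly"
  assumes "((\<lambda>x. poly p (of_real x + \<tau>)) \<longlongrightarrow> 0) at_top"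
  shows "p = 0"
proof (rule ccontr)
  assume "p \<noteq> 0"
  then obtain c where "((\<lambda>x. inverse (poly p (of_real x + \<tau>))) \<longlongrightarrow> c) at_top"
    using tendsto_inverse_poly_horizontal by blast
  from tendsto_mult[OF assms this]
  have lim: "((\<lambda>x. poly p (of_real x + \<tau>) * inverse (poly p (of_real x + \<tau>))) \<longlongrightarrow> 0) at_top" by simp
  have "((\<lambda>_::real. 1 :: complex) \<longlongrightarrow> 0) at_top"
    by (rule Lim_transform_eventually[OF lim],
        rule eventually_mono[OF poly_eventually_nonzero_horizontal[OF \<open>p \<noteq> 0\<close>, of \<tau>]]) simp
  then show False by (simp add: tendsto_const_iff)
qed

section \<open>Finite differences of a polynomial in the exponent\<close>

lemma degree_shift_diff_less:
  fixes p :: "'a :: idom poly"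
  assumes "degree p > 0"
  shows "degree (pcompose p [:c, 1:] - p) < degree p"
proof (cases "pcompose p [:c, 1:] - p = 0")
  case True
  then show ?thesis using assms by simp
next
  case False
  have deg: "degree (pcompose p [:c, 1:]) = degree p" by (simp add: degree_pcompose)
  have "lead_coeff (pcompose p [:c, 1:]) = lead_coeff p" by (subst lead_coeff_comp) auto
  then have "coeff (pcompose p [:c, 1:] - p) (degree p) = 0" by (simp add: deg)
  moreover have "degree (pcompose p [:c, 1:] - p) \<le> degree p"
    using degree_diff_le[of "pcompose p [:c, 1:]" "degree p" p] deg by simp
  ultimately show ?thesis using False
    by (intro degree_less_if_less_eqI)
qed

text \<open>Induction on the degree: the difference \<open>d\<close> of \<open>g\<close> under a
  shift has smaller degree and inherits the hypothesis, so it is a constant with exponential 1.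
  Hence \<open>exp (g \<tau> - g 0) = 1\<close> for all \<tau>.\<close>

lemma poly_constant_if_exp_shift_tendsto_1:
  fixes g :: "complex poly"
  assumes "\<And>\<tau>. ((\<lambda>x. exp (poly g (of_real x + \<tau>) - poly g (of_real x))) \<longlongrightarrow> 1) at_top"
  shows "degree g = 0"
  using assms
proof (induction "degree g" arbitrary: g rule: less_induct)
  case less
  show ?case
  proof (rule ccontr)
    assume pos: "degree g \<noteq> 0"
    have "exp (poly g \<tau> - poly g 0) = 1" for \<tau>
    proof -
      define d where "d = pcompose g [:\<tau>, 1:] - g"
      have d: "poly d s = poly g (s + \<tau>) - poly g s" for s
        by (simp add: d_def poly_pcompose add.commute)
      have "degree d = 0"
      proof (rule less.hyps)
        show "degree d < degree g" unfolding d_def using pos by (intro degree_shift_diff_less) simp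
        fix \<sigma>
        let ?e = "\<lambda>\<tau> x. exp (poly g (of_real x + \<tau>) - poly g (of_real x))"
        \<comment> \<open>The second difference of \<open>g\<close> for the shifts \<sigma> and
          \<tau> is the first difference of \<open>d\<close>, so its exponential is a quotient of
          expressions tending to 1.\<close>
        have "((\<lambda>x. ?e (\<sigma> + \<tau>) x / (?e \<sigma> x * ?e \<tau> x)) \<longlongrightarrow> 1 / (1 * 1)) at_top"
          by (intro tendsto_intros less.prems) auto
        moreover have "?e (\<sigma> + \<tau>) x / (?e \<sigma> x * ?e \<tau> x) = exp (poly d (of_real x + \<sigma>) - poly d (of_real x))" for x
          unfolding d exp_add[symmetric] exp_diff[symmetric] by (simp add: algebra_simps)
        ultimately show "((\<lambda>x. exp (poly d (of_real x + \<sigma>) - poly d (of_real x))) \<longlongrightarrow> 1) at_top" by simp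
      qed
      then obtain c where c: "d = [:c:]" by (rule degree_eq_zeroE)
      have "((\<lambda>x::real. exp c) \<longlongrightarrow> 1) at_top"
        using less.prems[of \<tau>] by (simp add: d[symmetric] c)
      then have "exp c = 1" by (simp add: tendsto_const_iff)
      moreover have "poly g \<tau> - poly g 0 = c" using d[of 0] by (simp add: c)
      ultimately show ?thesis by simp
    qed
    note const = this
    \<comment> \<open>The exponential determines \<open>g \<tau> - g 0\<close> only modulo its
      periods; differentiating in \<tau> removes this ambiguity.\<close>
    have "poly (pderiv g) \<tau> = 0" for \<tau>
    proof -
      have "((\<lambda>\<tau>. exp (poly g \<tau> - poly g 0)) has_field_derivative exp (poly g \<tau> - poly g 0) * poly (pderiv g) \<tau>) (at \<tau>)"
        by (auto intro!: derivative_eq_intros)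
      moreover have "((\<lambda>\<tau>. exp (poly g \<tau> - poly g 0)) has_field_derivative 0) (at \<tau>)"
        unfolding const by simp
      ultimately have "exp (poly g \<tau> - poly g 0) * poly (pderiv g) \<tau> = 0" by (rule DERIV_unique)
      then show ?thesis by simp
    qed
    then have "pderiv g = 0" using poly_all_0_iff_0 by blast
    then show False using pos by (simp add: pderiv_eq_0_iff)
  qed
qed

section \<open>Exponential decay of a Dirichlet series minus its first term\<close>

text \<open>By the Ramanujan bound with exponent 1, the term of index \<open>m \<ge> 2\<close> is at
  most \<open>C * m powr (1 - Re s)\<close>. This splits into \<open>m powr (- 3)\<close>, which is
  summable, and \<open>m powr (4 - Re s)\<close>, which for \<open>Re s \<ge> 4\<close> is largest
  at \<open>m = 2\<close>.\<close>

lemma extended_Selberg_decay: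
  assumes "L \<in> extended_Selberg"
  shows "\<exists>K. \<forall>s. Re s \<ge> 4 \<longrightarrow> norm (L s - 1) \<le> K * 2 powr (- Re s)"
proof -
  obtain a :: "nat \<Rightarrow> complex" where a1: "a 1 = 1"
    and O: "(\<lambda>n. norm (a n)) \<in> O(\<lambda>n. real n powr 1)"
    and sums: "\<And>s. Re s > 1 \<Longrightarrow> (\<lambda>n. a (Suc n) / of_nat (Suc n) powr s) sums L s"
  proof -
    from assms obtain a where "a 1 = 1 \<and>
        (\<forall>\<epsilon>>0. (\<lambda>n. norm (a n)) \<in> O(\<lambda>n. real n powr \<epsilon>)) \<and>
        (\<forall>s. Re s > 1 \<longrightarrow> (\<lambda>n. a (Suc n) / of_nat (Suc n) powr s) sums L s)"
      unfolding extended_Selberg_def by blast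
    then show ?thesis using that[of a] zero_less_one by blast
  qed
  obtain c where "c > 0" and "eventually (\<lambda>n. norm (norm (a n)) \<le> c * norm (real n powr 1)) sequentially"
    using O by (elim landau_o.bigE)
  then obtain N where N: "\<And>n. n \<ge> N \<Longrightarrow> norm (a n) \<le> c * real n"
    by (auto simp: eventually_sequentially)
  \<comment> \<open>The sum covers the indices below \<open>N\<close>, where the Landau bound says
    nothing.\<close>
  define C where "C = c + (\<Sum>n<N. norm (a n))"
  have C: "norm (a n) \<le> C * real n" if "n > 0" for n
  proof (cases "n < N")
    case True
    then have "norm (a n) \<le> (\<Sum>n<N. norm (a n))"
      by (intro member_le_sum) auto
    also have "\<dots> \<le> C" using \<open>c > 0\<close> by (simp add: C_def)
    also have "\<dots> \<le> C * real n"
      using mult_left_mono[of 1 "real n" C] that \<open>c > 0\<close> by (simp add: C_def sum_nonneg add_nonneg_nonneg)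
    finally show ?thesis .
  next
    case False
    then have "norm (a n) \<le> c * real n" using N by simp
    also have "\<dots> \<le> C * real n" by (intro mult_right_mono) (auto simp: C_def sum_nonneg)
    finally show ?thesis .
  qed
  have C0: "C \<ge> 0" using \<open>c > 0\<close> by (simp add: C_def sum_nonneg add_nonneg_nonneg)
  define b where "b = (\<lambda>n. inverse (real (n + 2) ^ 3))"
  have b: "summable b"
    unfolding b_def by (rule summable_ignore_initial_segment[OF inverse_power_summable]) simp
  show ?thesis
  proof (intro exI allI impI)
    fix s assume s: "Re s \<ge> 4"
    let ?t = "\<lambda>n. a (Suc n) / of_nat (Suc n) powr s"
    \<comment> \<open>Removing the term \<open>a 1 = 1\<close> leaves the indices
      \<open>n + 2\<close> of the Dirichlet series.\<close>
    have "(\<lambda>n. ?t (n + 1)) sums (L s - (\<Sum>i<1. ?t i))"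
      using sums[of s] s by (subst sums_iff_shift) auto
    then have S: "(\<lambda>n. ?t (n + 1)) sums (L s - 1)" by (simp add: a1[simplified])
    have le: "norm (?t (n + 1)) \<le> C * 16 * 2 powr (- Re s) * b n" for n
    proof -
      let ?m = "real (n + 2)"
      have "norm (?t (n + 1)) = norm (a (n + 2)) / ?m powr Re s"
        using norm_powr_real_powr[of "of_nat (n + 2)" s] by (simp add: norm_divide)
      also have "\<dots> \<le> C * ?m / ?m powr Re s" using C[of "n + 2"] by (intro divide_right_mono) auto
      also have "\<dots> = C * ?m powr (1 - Re s)" by (simp add: powr_diff)
      also have "?m powr (1 - Re s) = ?m powr (- 3) * ?m powr (4 - Re s)"
        by (simp add: powr_add[symmetric])
      also have "?m powr (-3) = b n"
        using powr_realpow[of ?m 3] by (simp add: powr_minus b_def)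
      also have "C * (b n * ?m powr (4 - Re s)) \<le> C * (b n * 2 powr (4 - Re s))"
        using s C0 by (intro mult_left_mono powr_mono2') (auto simp: b_def)
      also have "2 powr (4 - Re s) = 16 * 2 powr (- Re s)"
        using powr_realpow[of 2 4] by (simp add: powr_diff powr_minus field_simps)
      finally show ?thesis by (simp add: mult_ac)
    qed
    have "norm (suminf (\<lambda>n. ?t (n + 1))) \<le> suminf (\<lambda>n. C * 16 * 2 powr (- Re s) * b n)"
      by (rule norm_suminf_le[OF le summable_mult[OF b]])
    also have "\<dots> = C * 16 * 2 powr (- Re s) * suminf b" by (rule suminf_mult[OF b])
    finally show "norm (L s - 1) \<le> (C * 16 * suminf b) * 2 powr (- Re s)"
      using sums_unique[OF S] by (simp add: mult_ac)
  qed
qed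

section \<open>The difference of an L-function and a rational function\<close>

lemma zorder_mult_nonzero:
  assumes "c analytic_on {z}" "f analytic_on {z}" "c z \<noteq> 0"
    and "eventually (\<lambda>w. c w * f w \<noteq> 0) (at z)"
  shows "zorder (\<lambda>w. c w * f w) z = zorder f z"
  using assms by (simp add: zorder_times_analytic zorder_eq_0I)

text \<open>At a pole both values are 0, elsewhere both are the limit of the same germ. This extends
  an identity across a finite exceptional set.\<close>

lemma nicely_meromorphic_on_eq:
  assumes "f nicely_meromorphic_on {z}" "g nicely_meromorphic_on {z}"
    and ev: "eventually (\<lambda>w. f w = g w) (at z)"
  shows "f z = g z"
proof (cases "is_pole f z")
  case True
  then have "is_pole g z" using is_pole_cong[OF ev refl] by simp
  then show ?thesis using True assms by (simp add: is_pole_zero_at_nicely_mero)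
next
  case False
  then have "\<not> is_pole g z" using is_pole_cong[OF ev refl] by simp
  with False have "f \<midarrow>z\<rightarrow> f z" "g \<midarrow>z\<rightarrow> g z"
    using assms by (auto simp: nicely_meromorphic_on_def)
  then show ?thesis using tendsto_cong[OF ev] tendsto_unique trivial_limit_at by blast
qed

text \<open>Off the zeros of \<open>q\<close>, the numerator is
  \<open>(q - p) + q * (L - 1)\<close>. The second summand decays exponentially, whereas the nonzero
  polynomial \<open>q - p\<close> has an inverse with a finite limit.\<close>

lemma extended_Selberg_minus_rational_asymp:
  fixes p q :: "complex poly"
  assumes L: "L \<in> extended_Selberg" and q: "q \<noteq> 0" and pq: "q - p \<noteq> 0"
  shows "((\<lambda>x. poly q (of_real x + \<tau>) *
      (L (of_real x + \<tau>) - poly p (of_real x + \<tau>) / poly q (of_real x + \<tau>)) /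
      poly (q - p) (of_real x + \<tau>)) \<longlongrightarrow> 1) at_top"
proof -
  obtain K where K: "\<And>s. Re s \<ge> 4 \<Longrightarrow> norm (L s - 1) \<le> K * 2 powr (- Re s)"
    using extended_Selberg_decay[OF L] by blast
  obtain c where c: "((\<lambda>x. inverse (poly (q - p) (of_real x + \<tau>))) \<longlongrightarrow> c) at_top"
    using tendsto_inverse_poly_horizontal[OF pq] by blast
  have "((\<lambda>x. 1 + (poly q (of_real x + \<tau>) * (L (of_real x + \<tau>) - 1)) *
      inverse (poly (q - p) (of_real x + \<tau>))) \<longlongrightarrow> 1 + 0 * c) at_top"
    by (intro tendsto_intros tendsto_poly_times_decaying[OF K] c)
  then have lim: "((\<lambda>x. 1 + (poly q (of_real x + \<tau>) * (L (of_real x + \<tau>) - 1)) *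
      inverse (poly (q - p) (of_real x + \<tau>))) \<longlongrightarrow> 1) at_top"
    by simp
  show ?thesis
  proof (rule Lim_transform_eventually[OF lim])
    show "eventually (\<lambda>x. 1 + (poly q (of_real x + \<tau>) * (L (of_real x + \<tau>) - 1)) *
        inverse (poly (q - p) (of_real x + \<tau>)) =
        poly q (of_real x + \<tau>) *
        (L (of_real x + \<tau>) - poly p (of_real x + \<tau>) / poly q (of_real x + \<tau>)) /
        poly (q - p) (of_real x + \<tau>)) at_top"
      using poly_eventually_nonzero_horizontal[OF q, of \<tau>]
        poly_eventually_nonzero_horizontal[OF pq, of \<tau>]
    proof eventually_elim
      case (elim x)
      then show ?case by (simp add: field_simps)
    qed
  qed
qed

text \<open>\<open>Z\<close> contains all possible poles of \<open>L\<close> and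
  \<open>p / q\<close>, and \<open>N\<close> is what remains of the difference after clearing them.
  Since this may create zeros on \<open>Z\<close>, those are moved into \<open>P\<close>. Off
  \<open>Z\<close>, \<open>G\<close> has the zeros of the difference with their
  multiplicities.\<close>

lemma extended_Selberg_minus_rational_numerator:
  fixes p q :: "complex poly"
  assumes L: "L \<in> extended_Selberg" and q: "q \<noteq> 0" and pq: "q - p \<noteq> 0"
    and Z: "Z = insert 1 {z. poly q z = 0}"
  obtains N G P k where
    "exp_poly_bounded N" "N holomorphic_on UNIV" "G holomorphic_on UNIV" "P \<noteq> 0"
    "\<And>s. N s = poly P s * G s"
    "\<And>s. s \<notin> Z \<Longrightarrow> N s = (s - 1) ^ k * (poly q s * (L s - poly p s / poly q s))"
    "\<And>s. s \<notin> Z \<Longrightarrow> poly P s \<noteq> 0"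
    "\<And>s. s \<in> Z \<Longrightarrow> G s \<noteq> 0"
    "\<And>s. zorder G s \<ge> 0"
    "\<And>s m. s \<notin> Z \<Longrightarrow> zero_of_multiplicity (\<lambda>s. L s - poly p s / poly q s) s m \<longleftrightarrow>
      G s = 0 \<and> zorder G s = int m"
    "eventually (\<lambda>x. N (of_real x) \<noteq> 0) at_top"
proof -
  define f where "f = (\<lambda>s. L s - poly p s / poly q s)"
  obtain k F where F: "entire_finite_order F" "\<And>s. s \<noteq> 1 \<Longrightarrow> F s = (s - 1) ^ k * L s"
    using L unfolding extended_Selberg_def by blast
  then have holF: "F holomorphic_on UNIV" by (simp add: entire_finite_order_def)
  have finZ: "finite Z" using q by (simp add: Z poly_roots_finite)
  define D where "D = [:-1, 1:] ^ k * q"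
  have D: "poly D s = (s - 1) ^ k * poly q s" for s by (simp add: D_def)
  define N where "N = (\<lambda>s. F s * poly q s + poly (- p * [:-1, 1:] ^ k) s)"
  have holN: "N holomorphic_on UNIV" unfolding N_def by (intro holomorphic_intros holF)
  have bdN: "exp_poly_bounded N"
    unfolding N_def using entire_finite_order_imp_exp_poly_bounded[OF F(1)]
    by (intro exp_poly_bounded_add exp_poly_bounded_mult exp_poly_bounded_poly)
  have N_eq: "N s = poly D s * f s" if "s \<notin> Z" for s
    using that F(2)[of s] by (simp add: N_def D Z f_def field_simps)
  \<comment> \<open>The asymptotic relation shows that \<open>N\<close> does not vanish identically,
    so that its zeros have finite order and can be divided out.\<close>
  have evN: "eventually (\<lambda>x. N (of_real x) \<noteq> 0) at_top"
  proof -
    have "eventually (\<lambda>x. poly q (of_real x + 0) * f (of_real x + 0) / poly (q - p) (of_real x + 0) \<noteq> 0) at_top"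
      using extended_Selberg_minus_rational_asymp[OF L q pq, of 0] unfolding f_def
      by (rule tendsto_imp_eventually_ne) simp
    then show ?thesis
      using poly_eventually_nonzero_horizontal[of "[:-1, 1:] * q" 0]
    proof (rule eventually_elim2)
      show "[:-1, 1:] * q \<noteq> 0" unfolding mult_eq_0_iff using q by simp
      fix x :: real
      assume "poly q (of_real x + 0) * f (of_real x + 0) / poly (q - p) (of_real x + 0) \<noteq> 0"
        and "poly ([:-1, 1:] * q) (of_real x + 0) \<noteq> 0"
      then show "N (of_real x) \<noteq> 0" using N_eq[of "of_real x"] by (auto simp: D Z)
    qed
  qed
  then obtain w where w: "N w \<noteq> 0" using eventually_happens[OF evN] by auto
  obtain m G where G: "G holomorphic_on UNIV" "\<And>z. z \<in> Z \<Longrightarrow> G z \<noteq> 0"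
    "\<And>s. N s = (\<Prod>z\<in>Z. (s - z) ^ m z) * G s"
    using entire_factor_zeros[OF holN w finZ] by metis
  define P where "P = (\<Prod>z\<in>Z. [:- z, 1:] ^ m z)"
  have P: "poly P s = (\<Prod>z\<in>Z. (s - z) ^ m z)" for s
    by (simp add: P_def poly_prod)
  have NPG: "N s = poly P s * G s" for s by (simp add: P G(3))
  have P_nz: "poly P s \<noteq> 0" if "s \<notin> Z" for s
    using that finZ by (auto simp: P)
  have Gw: "G w \<noteq> 0" using w NPG by auto
  have zo: "zorder G s \<ge> 0" for s
  proof -
    have "\<exists>w\<in>UNIV. G w \<noteq> 0" using Gw by blast
    from zorder_exist_zero[OF G(1) open_UNIV connected_UNIV UNIV_I this, of s] show ?thesis
      by (auto split: if_splits)
  qed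
  have mult: "zero_of_multiplicity f s m \<longleftrightarrow> G s = 0 \<and> zorder G s = int m" if s: "s \<notin> Z" for s m
  proof -
    have op: "open (- Z)" using finZ by (simp add: finite_imp_closed open_Compl)
    have D_nz: "poly D z \<noteq> 0" if "z \<notin> Z" for z using that by (simp add: D Z)
    have "f holomorphic_on (- Z)"
      by (rule holomorphic_transform[where f = "\<lambda>s. N s / poly D s"])
         (use D_nz N_eq in \<open>auto intro!: holomorphic_intros holomorphic_on_subset[OF holN]\<close>)
    then have anf: "f analytic_on {s}" using op s by (auto simp: analytic_at)
    have an_poly: "poly r analytic_on {s}" for r
      using poly_holomorphic_on[OF holomorphic_on_ident, of r UNIV]
      by (auto simp: analytic_at)
    have anG: "G analytic_on {s}" using G(1) by (auto simp: analytic_at)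
    have evN0: "eventually (\<lambda>z. N z \<noteq> 0) (at s)"
      using non_zero_neighbour_alt[OF holN, of s w] w by (auto elim: eventually_mono)
    have evZ: "eventually (\<lambda>z. z \<in> - Z) (at s)"
      using op s by (intro eventually_at_in_open') auto
    have evDf: "eventually (\<lambda>z. N z = poly D z * f z) (at s)"
      using evZ by eventually_elim (simp add: N_eq)
    \<comment> \<open>Neither \<open>poly D\<close> nor \<open>poly P\<close> vanishes at
      \<open>s\<close>, so the order is preserved from \<open>f\<close> to \<open>N\<close> and from
      \<open>N\<close> to \<open>G\<close>.\<close>
    have "zorder N s = zorder (\<lambda>z. poly D z * f z) s" by (rule zorder_cong[OF evDf refl])
    also have "\<dots> = zorder f s"
    proof (rule zorder_mult_nonzero[OF _ anf])
      show "eventually (\<lambda>z. poly D z * f z \<noteq> 0) (at s)"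
        using evN0 evDf by eventually_elim simp
    qed (use D_nz s in \<open>auto intro!: an_poly\<close>)
    finally have "zorder f s = zorder N s" ..
    also have "\<dots> = zorder (\<lambda>z. poly P z * G z) s"
      using NPG by presburger
    also have "\<dots> = zorder G s"
      by (rule zorder_mult_nonzero[OF _ anG])
         (use P_nz s evN0 NPG in \<open>auto intro!: an_poly\<close>)
    finally have "zorder f s = zorder G s" .
    moreover have "f s = 0 \<longleftrightarrow> G s = 0"
      using N_eq[OF s] NPG[of s] D_nz[OF s] P_nz[OF s] by auto
    moreover have "eventually (\<lambda>z. f z \<noteq> 0) (at s)"
      using evN0 evDf by eventually_elim simp
    ultimately show ?thesis
      unfolding zero_of_multiplicity_def isolated_zero_analytic_iff[OF anf] by auto
  qed
  show ?thesis
  proof (rule that[OF bdN holN G(1) _ NPG _ P_nz G(2) zo _ evN])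
    show "P \<noteq> 0" using w NPG[of w] by auto
    show "N s = (s - 1) ^ k * (poly q s * (L s - poly p s / poly q s))" if "s \<notin> Z" for s
      using N_eq[OF that] by (simp add: D f_def mult.assoc)
  qed (use mult f_def in auto)
qed

section \<open>From equal zeros to equal functions\<close>

theorem theorem2:
  fixes h L1 L2 :: "complex \<Rightarrow> complex"
  assumes "rational_function h" and "h \<noteq> (\<lambda>_. 1)"
    and "L1 \<in> extended_Selberg" and "L2 \<in> extended_Selberg"
    and "same_zeros_with_multiplicity (\<lambda>s. L1 s - h s) (\<lambda>s. L2 s - h s)"
  shows "L1 = L2"
proof -
  obtain p q where q: "q \<noteq> 0" and cop: "coprime p q" and h: "h = (\<lambda>s. poly p s / poly q s)"
    using assms(1) unfolding rational_function_def by blast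
  \<comment> \<open>In lowest terms, \<open>p = q\<close> would make both a nonzero constant and
    \<open>h\<close> equal to 1 everywhere.\<close>
  have pq: "q - p \<noteq> 0"
  proof
    assume "q - p = 0"
    then have "p = q" by simp
    with cop have "is_unit q" by simp
    then obtain c where c: "q = [:c:]" by (auto simp: is_unit_poly_iff)
    with q have "c \<noteq> 0" by auto
    with \<open>p = q\<close> c h assms(2) show False by simp
  qed
  define Z where "Z = insert 1 {z. poly q z = 0}"
  define \<Phi> where "\<Phi> = (\<lambda>L s. poly q s * (L s - poly p s / poly q s))"
  obtain N1 G1 P1 k1 where 1:
    "exp_poly_bounded N1" "N1 holomorphic_on UNIV" "G1 holomorphic_on UNIV" "P1 \<noteq> 0"
    "\<And>s. N1 s = poly P1 s * G1 s"
    "\<And>s. s \<notin> Z \<Longrightarrow> N1 s = (s - 1) ^ k1 * \<Phi> L1 s"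
    "\<And>s. s \<notin> Z \<Longrightarrow> poly P1 s \<noteq> 0"
    "\<And>s. s \<in> Z \<Longrightarrow> G1 s \<noteq> 0"
    "\<And>s. zorder G1 s \<ge> 0"
    "\<And>s m. s \<notin> Z \<Longrightarrow> zero_of_multiplicity (\<lambda>s. L1 s - h s) s m \<longleftrightarrow>
      G1 s = 0 \<and> zorder G1 s = int m"
    "eventually (\<lambda>x. N1 (of_real x) \<noteq> 0) at_top"
    unfolding h \<Phi>_def
  proof (rule extended_Selberg_minus_rational_numerator[OF assms(3) q pq Z_def], goal_cases)
    case 1
    show ?case by (rule 1(1)[OF 1(2-)])
  qed
  obtain N2 G2 P2 k2 where 2:
    "exp_poly_bounded N2" "N2 holomorphic_on UNIV" "G2 holomorphic_on UNIV" "P2 \<noteq> 0"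
    "\<And>s. N2 s = poly P2 s * G2 s"
    "\<And>s. s \<notin> Z \<Longrightarrow> N2 s = (s - 1) ^ k2 * \<Phi> L2 s"
    "\<And>s. s \<notin> Z \<Longrightarrow> poly P2 s \<noteq> 0"
    "\<And>s. s \<in> Z \<Longrightarrow> G2 s \<noteq> 0"
    "\<And>s. zorder G2 s \<ge> 0"
    "\<And>s m. s \<notin> Z \<Longrightarrow> zero_of_multiplicity (\<lambda>s. L2 s - h s) s m \<longleftrightarrow>
      G2 s = 0 \<and> zorder G2 s = int m"
    "eventually (\<lambda>x. N2 (of_real x) \<noteq> 0) at_top"
    unfolding h \<Phi>_def
  proof (rule extended_Selberg_minus_rational_numerator[OF assms(4) q pq Z_def], goal_cases)
    case 1
    show ?case by (rule 1(1)[OF 1(2-)])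
  qed
  have same: "G1 s = 0 \<and> zorder G1 s = int m \<longleftrightarrow> G2 s = 0 \<and> zorder G2 s = int m"
    if "s \<notin> Z" for s m
    using assms(5) 1(10)[OF that] 2(10)[OF that] by (simp add: same_zeros_with_multiplicity_def)
  \<comment> \<open>On \<open>Z\<close> neither function vanishes. Off \<open>Z\<close> the orders
    are nonnegative, so \<open>nat\<close> turns them into multiplicities to which
    \<open>same\<close> applies.\<close>
  have zeros: "G1 s = 0 \<longleftrightarrow> G2 s = 0" for s
    using same[of s "nat (zorder G1 s)"] same[of s "nat (zorder G2 s)"] 1(8,9)[of s] 2(8,9)[of s]
    by auto
  have zorders: "zorder G1 s = zorder G2 s" for s
  proof (cases "G1 s = 0")
    case True
    then have "s \<notin> Z" using 1(8) by blast
    then show ?thesis using True same[of s "nat (zorder G1 s)"] 1(9)[of s] by simp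
  next
    case False
    have "G1 analytic_on {s}" "G2 analytic_on {s}" using 1(3) 2(3) by (auto simp: analytic_at)
    then show ?thesis using False zeros[of s] by (simp add: zorder_eq_0I)
  qed
  obtain E where E: "E holomorphic_on UNIV" "\<And>z. E z \<noteq> 0" "\<And>z. G1 z = E z * G2 z"
    by (rule holomorphic_zorder_factorization[OF 1(3) open_UNIV connected_UNIV 2(3)])
       (use zeros zorders in auto)
  \<comment> \<open>Multiplying \<open>G1 = E * G2\<close> by \<open>P1 * P2\<close> brings in
    \<open>N1\<close> and \<open>N2\<close>, whose growth is known, and so exhibits \<open>E\<close>
    as a quotient of functions of finite order.\<close>
  have N12: "E s * (poly P1 s * N2 s) = poly P2 s * N1 s" for s
    by (simp add: 1(5) 2(5) E(3))
  have "eventually (\<lambda>x. poly P1 (of_real x + 0) * N2 (of_real x) \<noteq> 0) at_top"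
    using poly_eventually_nonzero_horizontal[OF 1(4), of 0] 2(11) by eventually_elim simp
  then obtain c where c: "poly P1 c * N2 c \<noteq> 0" by (auto dest: eventually_happens)
  have "exp_poly_bounded E"
  proof (rule exp_poly_bounded_quotient[where g = "\<lambda>s. poly P1 s * N2 s", OF E(1) _ c E(2)])
    show "(\<lambda>s. poly P1 s * N2 s) holomorphic_on UNIV" by (intro holomorphic_intros 2)
    show "exp_poly_bounded (\<lambda>s. poly P1 s * N2 s)"
      by (intro exp_poly_bounded_mult[OF exp_poly_bounded_poly] 2)
    show "exp_poly_bounded (\<lambda>s. E s * (poly P1 s * N2 s))"
      unfolding N12 by (intro exp_poly_bounded_mult[OF exp_poly_bounded_poly] 1)
  qed
  then obtain g where g: "\<And>z. E z = exp (poly g z)"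
    using exp_poly_bounded_nonvanishing[OF E(1,2)] by blast
  \<comment> \<open>\<open>U\<close> and \<open>V\<close> collect the polynomial factors, so that
    off \<open>Z\<close> the relation becomes
    \<open>U * \<Phi> L1 = E * V * \<Phi> L2\<close>.\<close>
  define U where "U = P2 * [:-1, 1:] ^ k1"
  define V where "V = P1 * [:-1, 1:] ^ k2"
  have UV: "U \<noteq> 0" "V \<noteq> 0" using 1(4) 2(4) by (auto simp: U_def V_def)
  have U_nz: "poly U s \<noteq> 0" if "s \<notin> Z" for s
    using 2(7)[OF that] that by (auto simp: U_def Z_def)
  have key: "poly U s * \<Phi> L1 s = E s * poly V s * \<Phi> L2 s" if "s \<notin> Z" for s
    using N12[of s] 1(6)[OF that] 2(6)[OF that] by (simp add: U_def V_def mult_ac)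
  have \<Phi>_lim: "((\<lambda>x. \<Phi> L (of_real x + \<tau>) / poly (q - p) (of_real x + \<tau>)) \<longlongrightarrow> 1) at_top"
    if "L \<in> extended_Selberg" for L \<tau>
    unfolding \<Phi>_def by (rule extended_Selberg_minus_rational_asymp[OF that q pq])
  define w where "w = (\<lambda>s. \<Phi> L1 s / \<Phi> L2 s)"
  have ev: "eventually (\<lambda>x. of_real x + \<tau> \<notin> Z \<and> poly (q - p) (of_real x + \<tau>) \<noteq> 0 \<and>
      \<Phi> L2 (of_real x + \<tau>) \<noteq> 0 \<and> poly V (of_real x + \<tau>) \<noteq> 0) at_top" for \<tau>
  proof -
    have "eventually (\<lambda>x. \<Phi> L2 (of_real x + \<tau>) / poly (q - p) (of_real x + \<tau>) \<noteq> 0) at_top"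
      by (rule tendsto_imp_eventually_ne[OF \<Phi>_lim[OF assms(4)]]) simp
    moreover have "eventually (\<lambda>x. poly ([:-1, 1:] * q * V) (of_real x + \<tau>) \<noteq> 0) at_top"
      by (rule poly_eventually_nonzero_horizontal) (unfold mult_eq_0_iff, use q UV in simp)
    ultimately show ?thesis by eventually_elim (auto simp: Z_def)
  qed
  have E_w: "eventually (\<lambda>x. E (of_real x + \<tau>) =
      w (of_real x + \<tau>) * poly U (of_real x + \<tau>) / poly V (of_real x + \<tau>)) at_top" for \<tau>
    using ev[of \<tau>]
  proof eventually_elim
    case (elim x)
    then show ?case using key[of "of_real x + \<tau>"] by (simp add: w_def field_simps)
  qed
  have w_lim: "((\<lambda>x. w (of_real x + \<tau>)) \<longlongrightarrow> 1) at_top" for \<tau>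
  proof -
    have lim: "((\<lambda>x. (\<Phi> L1 (of_real x + \<tau>) / poly (q - p) (of_real x + \<tau>)) /
        (\<Phi> L2 (of_real x + \<tau>) / poly (q - p) (of_real x + \<tau>))) \<longlongrightarrow> 1 / 1) at_top"
      by (intro tendsto_divide \<Phi>_lim assms) auto
    have "((\<lambda>x. w (of_real x + \<tau>)) \<longlongrightarrow> 1 / 1) at_top"
      by (rule Lim_transform_eventually[OF lim], rule eventually_mono[OF ev[of \<tau>]])
         (simp add: w_def)
    then show ?thesis by simp
  qed
  \<comment> \<open>The exponential in question is \<open>E (x + \<tau>) / E x\<close>, to which
    \<open>w\<close>, \<open>U\<close> and \<open>V\<close> each contribute a factor with limit
    1.\<close>
  have "degree g = 0"
  proof (rule poly_constant_if_exp_shift_tendsto_1)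
    fix \<tau> :: complex
    have "((\<lambda>x. w (of_real x + \<tau>) / w (of_real x + 0) *
        (poly U (of_real x + \<tau>) / poly U (of_real x)) /
        (poly V (of_real x + \<tau>) / poly V (of_real x))) \<longlongrightarrow> 1 / 1 * 1 / 1) at_top"
      by (intro tendsto_intros w_lim tendsto_poly_shift_ratio UV) auto
    then have lim: "((\<lambda>x. w (of_real x + \<tau>) / w (of_real x + 0) *
        (poly U (of_real x + \<tau>) / poly U (of_real x)) /
        (poly V (of_real x + \<tau>) / poly V (of_real x))) \<longlongrightarrow> 1) at_top"
      by simp
    show "((\<lambda>x. exp (poly g (of_real x + \<tau>) - poly g (of_real x))) \<longlongrightarrow> 1) at_top"
    proof (rule Lim_transform_eventually[OF lim])
      show "eventually (\<lambda>x. w (of_real x + \<tau>) / w (of_real x + 0) *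
          (poly U (of_real x + \<tau>) / poly U (of_real x)) /
          (poly V (of_real x + \<tau>) / poly V (of_real x)) =
          exp (poly g (of_real x + \<tau>) - poly g (of_real x))) at_top"
        using E_w[of \<tau>] E_w[of 0] by eventually_elim (simp add: exp_diff g[symmetric])
    qed
  qed
  then obtain \<gamma> where \<gamma>: "g = [:\<gamma>:]" by (rule degree_eq_zeroE)
  define \<kappa> where "\<kappa> = exp \<gamma>"
  have \<kappa>: "E s = \<kappa>" for s by (simp add: g \<gamma> \<kappa>_def)
  \<comment> \<open>Subtracting \<open>U * \<Phi> L2\<close> from \<open>key\<close> gives
    \<open>q * U * (L1 - L2) = (\<kappa> * V - U) * \<Phi> L2\<close>. As \<open>\<Phi> L2\<close>
    is asymptotic to \<open>q - p\<close> and \<open>L1 - L2\<close> decays exponentially, division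
    by \<open>\<Phi> L2\<close> shows that \<open>\<kappa> * V - U\<close> tends to 0.\<close>
  have "smult \<kappa> V - U = 0"
  proof (rule poly_zero_if_tendsto_zero_horizontal)
    obtain K1 where K1: "\<And>s. Re s \<ge> 4 \<Longrightarrow> norm (L1 s - 1) \<le> K1 * 2 powr (- Re s)"
      using extended_Selberg_decay[OF assms(3)] by blast
    obtain K2 where K2: "\<And>s. Re s \<ge> 4 \<Longrightarrow> norm (L2 s - 1) \<le> K2 * 2 powr (- Re s)"
      using extended_Selberg_decay[OF assms(4)] by blast
    have K: "norm (L1 s - L2 s) \<le> (K1 + K2) * 2 powr (- Re s)" if "Re s \<ge> 4" for s
      using K1[OF that] K2[OF that] norm_triangle_ineq4[of "L1 s - 1" "L2 s - 1"]
      by (simp add: algebra_simps)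
    obtain c where c: "((\<lambda>x. inverse (poly (q - p) (of_real x + 0))) \<longlongrightarrow> c) at_top"
      using tendsto_inverse_poly_horizontal[OF pq] by blast
    have "((\<lambda>x. poly (q * U) (of_real x + 0) * (L1 (of_real x + 0) - L2 (of_real x + 0)) *
        inverse (poly (q - p) (of_real x + 0)) /
        (\<Phi> L2 (of_real x + 0) / poly (q - p) (of_real x + 0))) \<longlongrightarrow> 0 * c / 1) at_top"
      by (intro tendsto_mult tendsto_divide tendsto_poly_times_decaying[OF K] c \<Phi>_lim assms) auto
    then have lim: "((\<lambda>x. poly (q * U) (of_real x + 0) * (L1 (of_real x + 0) - L2 (of_real x + 0)) *
        inverse (poly (q - p) (of_real x + 0)) /
        (\<Phi> L2 (of_real x + 0) / poly (q - p) (of_real x + 0))) \<longlongrightarrow> 0) at_top"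
      by simp
    show "((\<lambda>x. poly (smult \<kappa> V - U) (of_real x + 0)) \<longlongrightarrow> 0) at_top"
    proof (rule Lim_transform_eventually[OF lim])
      show "eventually (\<lambda>x. poly (q * U) (of_real x + 0) * (L1 (of_real x + 0) - L2 (of_real x + 0)) *
        inverse (poly (q - p) (of_real x + 0)) /
        (\<Phi> L2 (of_real x + 0) / poly (q - p) (of_real x + 0)) =
        poly (smult \<kappa> V - U) (of_real x + 0)) at_top"
        using ev[of 0]
      proof eventually_elim
        case (elim x)
        let ?s = "of_real x + 0 :: complex"
        have "poly (q * U) ?s * (L1 ?s - L2 ?s) = poly U ?s * \<Phi> L1 ?s - poly U ?s * \<Phi> L2 ?s"
          by (simp add: \<Phi>_def algebra_simps)
        also have "\<dots> = \<Phi> L2 ?s * poly (smult \<kappa> V - U) ?s"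
          using key[of ?s] elim by (simp add: \<kappa> algebra_simps)
        finally have eq: "poly (q * U) ?s * (L1 ?s - L2 ?s) = \<Phi> L2 ?s * poly (smult \<kappa> V - U) ?s" .
        show ?case
          unfolding eq using elim by (simp add: divide_inverse mult_ac del: poly_diff poly_smult add_0_right)
      qed
    qed
  qed
  then have U: "poly U s = \<kappa> * poly V s" for s
    by (metis eq_iff_diff_eq_0 poly_smult)
  have eq: "L1 s = L2 s" if "s \<notin> Z" for s
  proof -
    have "poly U s * \<Phi> L1 s = poly U s * \<Phi> L2 s" using key[OF that] by (simp add: \<kappa> U)
    then show ?thesis using U_nz[OF that] that by (simp add: \<Phi>_def Z_def)
  qed
  show ?thesis
  proof
    fix z
    \<comment> \<open>As \<open>Z\<close> is finite, a punctured neighbourhood of \<open>z\<close>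
      avoids it even when \<open>z\<close> lies in \<open>Z\<close>, and the normalisation then
      fixes the value at \<open>z\<close>.\<close>
    have "finite Z" using q by (simp add: Z_def poly_roots_finite)
    then have "open (- (Z - {z}))" by (intro open_Compl finite_imp_closed) simp
    then have "eventually (\<lambda>s. s \<in> - (Z - {z}) - {z}) (at z)"
      by (intro eventually_at_in_open) auto
    then have "eventually (\<lambda>s. L1 s = L2 s) (at z)"
      by (rule eventually_mono) (use eq in blast)
    moreover have "L1 nicely_meromorphic_on {z}" "L2 nicely_meromorphic_on {z}"
      using assms(3,4) nicely_meromorphic_on_subset unfolding extended_Selberg_def by blast+
    ultimately show "L1 z = L2 z" by (intro nicely_meromorphic_on_eq)
  qed
qed

end
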